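(* Let $p\in(0,\infty)$ and let $(X,d_X)$, $(Y,d_Y)$ be metric spaces. If $(X,d_X)$ is Markov $p$-convex and $(Y,d_Y)$ is a Lipschitz quotient of $X$, then $Y$ is also Markov $p$-convex.
   Context: Markov $p$-convexity: let $\{X_t\}_{t\in \mathbb{Z}}$ be a Markov chain on a state space $\Omega$. Given an integer $k$, $\{\widetilde X_t(k)\}_{t\in \mathbb{Z}}$ denotes the process which equals $X_t$ for times $t\le k$, and evolves independently (with respect to the same transition probabilities) for times $t>k$. For $p>0$, a metric space $(X,d_X)$ is called Markov $p$-convex with constant $\Pi$ if for every Markov chain $\{X_t\}_{t\in \mathbb{Z}}$ on a state space $\Omega$ and every $f:\Omega\to X$, $$\sum_{k=0}^{\infty}\sum_{t\in \mathbb{Z}}\frac{\mathbb{E}\left[d_X\left(f(X_t),f\left(\widetilde X_t\left(t-2^{k}\right)\right)\right)^p\right]}{2^{kp}}\le \Pi^p\sum_{t\in \mathbb{Z}}\mathbb{E}\left[d_X(f(X_t),f(X_{t-1}))^p\right].$$ The least such $\Pi$ is denoted $\Pi_p(X)$, and $X$ is called Markov $p$-convex if $\Pi_p(X)<\infty$. Lipschitz quotient: a surjective mapping $f:X\to Y$ is called a Lipschitz quotient if it is Lipschitz and there exists a constant $c>0$ such that for every $x\in X$ and $r>0$, $f(B_X(x,r))\supseteq B_Y(f(x),r/c)$, where $B_Z(z,r)$ denotes the ball of radius $r$ centered at $z$ in $Z$. $Y$ is a Lipschitz quotient of $X$ if such an $f:X\to Y$ exists. *)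

theory Defs
  imports "HOL-Probability.Probability"
begin

section \<open>Markov chains indexed by the integers\<close>

text \<open>
  State spaces are countable and discrete, since Markov convexity involves arbitrary maps
  \<open>f\<close> on the state space.  The transition probabilities \<open>K n\<close> (from time \<open>n\<close> to time \<open>n + 1\<close>)
  may depend on time.  Conditioning on an arbitrary finite window \<open>{m..n}\<close> of the past is the usual
  Markov property; there is no initial time.
\<close>

definition markov_chain ::
    "'s measure \<Rightarrow> (int \<Rightarrow> 'w::countable \<Rightarrow> 'w pmf) \<Rightarrow> (int \<Rightarrow> 's \<Rightarrow> 'w) \<Rightarrow> bool" where
  "markov_chain M K X \<longleftrightarrow>
     prob_space M \<and>
     (\<forall>t. X t \<in> M \<rightarrow>\<^sub>M count_space UNIV) \<and>
     (\<forall>m n a y. m \<le> n \<longrightarrow> \<P>(\<omega> in M. \<forall>i\<in>{m..n}. X i \<omega> = a i) > 0 \<longrightarrow>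
        \<P>(\<omega> in M. X (n + 1) \<omega> = y \<bar> \<forall>i\<in>{m..n}. X i \<omega> = a i) = pmf (K n (a n)) y)"

text \<open>
  \<open>Z\<close> is a version of the process that agrees with \<open>X\<close> up to time \<open>k\<close> and afterwards evolves
  independently with the same transition probabilities: from time \<open>k\<close> on, conditionally on the
  joint past, \<open>X\<close> and \<open>Z\<close> make independent steps distributed according to \<open>K\<close>.  This determines
  the joint law of \<open>X\<close> and \<open>Z\<close>.
\<close>

definition branched_copy ::
    "'s measure \<Rightarrow> (int \<Rightarrow> 'w::countable \<Rightarrow> 'w pmf) \<Rightarrow> (int \<Rightarrow> 's \<Rightarrow> 'w) \<Rightarrow> int
      \<Rightarrow> (int \<Rightarrow> 's \<Rightarrow> 'w) \<Rightarrow> bool" where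
  "branched_copy M K X k Z \<longleftrightarrow>
     (\<forall>t. Z t \<in> M \<rightarrow>\<^sub>M count_space UNIV) \<and>
     (\<forall>t\<le>k. \<forall>\<omega>\<in>space M. Z t \<omega> = X t \<omega>) \<and>
     (\<forall>m n a b x y. m \<le> n \<longrightarrow> k \<le> n \<longrightarrow>
        \<P>(\<omega> in M. \<forall>i\<in>{m..n}. X i \<omega> = a i \<and> Z i \<omega> = b i) > 0 \<longrightarrow>
        \<P>(\<omega> in M. X (n + 1) \<omega> = x \<and> Z (n + 1) \<omega> = y \<bar>
               \<forall>i\<in>{m..n}. X i \<omega> = a i \<and> Z i \<omega> = b i)
          = pmf (K n (a n)) x * pmf (K n (b n)) y)"

section \<open>Markov \<open>p\<close>-convexity\<close>

text \<open>All sums and expectations are taken in \<open>[0, \<infinity>]\<close>.\<close>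

definition markov_convexity_inequality ::
    "'x metric \<Rightarrow> real \<Rightarrow> real \<Rightarrow> 's measure \<Rightarrow> (int \<Rightarrow> 's \<Rightarrow> 'w)
      \<Rightarrow> (int \<Rightarrow> int \<Rightarrow> 's \<Rightarrow> 'w) \<Rightarrow> ('w \<Rightarrow> 'x) \<Rightarrow> bool" where
  "markov_convexity_inequality m p C M X Z f \<longleftrightarrow>
     (\<Sum>k::nat. \<Sum>\<^sub>\<infinity>t\<in>(UNIV::int set).
        (\<integral>\<^sup>+\<omega>. ennreal (mdist m (f (X t \<omega>)) (f (Z (t - 2 ^ k) t \<omega>)) powr p) \<partial>M)
          / ennreal (2 powr (real k * p)))
     \<le> ennreal (C powr p) *
        (\<Sum>\<^sub>\<infinity>t\<in>(UNIV::int set).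
          (\<integral>\<^sup>+\<omega>. ennreal (mdist m (f (X t \<omega>)) (f (X (t - 1) \<omega>)) powr p) \<partial>M))"

text \<open>
  A definition cannot quantify over types, so the state space is \<open>nat\<close> and the sample space is
  \<open>nat \<Rightarrow> nat\<close> (with any probability measure on any \<open>\<sigma>\<close>-algebra).  Both choices are universal: only
  the law of the countably many countable-valued variables \<open>X t\<close>, \<open>Z k t\<close> matters, and the lemma
  \<open>markov_convex_with_general\<close> below derives the inequality for every countable state space and
  every probability space.
\<close>

definition markov_convex_with :: "'x metric \<Rightarrow> real \<Rightarrow> real \<Rightarrow> bool" where
  "markov_convex_with m p C \<longleftrightarrow>
     (\<forall>(M :: (nat \<Rightarrow> nat) measure) (K :: int \<Rightarrow> nat \<Rightarrow> nat pmf) X Z f.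
        markov_chain M K X \<longrightarrow> (\<forall>k. branched_copy M K X k (Z k)) \<longrightarrow> range f \<subseteq> mspace m \<longrightarrow>
        markov_convexity_inequality m p C M X Z f)"

definition markov_convexity_constant :: "'x metric \<Rightarrow> real \<Rightarrow> ennreal" where
  "markov_convexity_constant m p = (INF C\<in>{C. 0 \<le> C \<and> markov_convex_with m p C}. ennreal C)"

definition markov_convex :: "'x metric \<Rightarrow> real \<Rightarrow> bool" where
  "markov_convex m p \<longleftrightarrow> markov_convexity_constant m p < \<infinity>"

lemma markov_convex_with_general:
  fixes M :: "'s measure" and K :: "int \<Rightarrow> 'w::countable \<Rightarrow> 'w pmf"
  assumes conv: "markov_convex_with m p C"
    and chain: "markov_chain M K X" and branched: "\<And>k. branched_copy M K X k (Z k)"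
    and f: "range f \<subseteq> mspace m"
  shows "markov_convexity_inequality m p C M X Z f"
proof -
  define S where "S = (PiM UNIV (\<lambda>_. count_space UNIV) :: (nat \<Rightarrow> nat) measure)"
  define enc where "enc = (\<lambda>u::int \<times> int option. to_nat u)"
  define \<Phi> where "\<Phi> = (\<lambda>\<omega> n. case (from_nat n :: int \<times> int option) of
      (t, None) \<Rightarrow> to_nat (X t \<omega>) | (t, Some k) \<Rightarrow> to_nat (Z k t \<omega>))"
  define N where "N = distr M S \<Phi>"
  define X' where "X' = (\<lambda>t (w::nat\<Rightarrow>nat). w (enc (t, None)))"
  define Z' where "Z' = (\<lambda>k t (w::nat\<Rightarrow>nat). if t \<le> k then X' t w else w (enc (t, Some k)))"
  define K' where "K' = (\<lambda>t n. map_pmf to_nat (K t (from_nat n)))"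
  define f' where "f' = (\<lambda>n::nat. f (from_nat n))"
  interpret prob_space M using chain by (simp add: markov_chain_def)
  have X[measurable]: "X t \<in> M \<rightarrow>\<^sub>M count_space UNIV" for t
    using chain by (simp add: markov_chain_def)
  have Z[measurable]: "Z k t \<in> M \<rightarrow>\<^sub>M count_space UNIV" for k t
    using branched by (simp add: branched_copy_def)
  have ZX: "Z k t \<omega> = X t \<omega>" if "t \<le> k" "\<omega> \<in> space M" for k t \<omega>
    using branched[of k] that by (simp add: branched_copy_def)
  have \<Phi>[measurable]: "\<Phi> \<in> M \<rightarrow>\<^sub>M S"
    unfolding S_def
  proof (rule measurable_PiM_single')
    fix n :: nat
    obtain t u where tu: "(from_nat n :: int \<times> int option) = (t, u)" by fastforce
    show "(\<lambda>\<omega>. \<Phi> \<omega> n) \<in> M \<rightarrow>\<^sub>M count_space UNIV"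
      by (cases u) (simp_all add: \<Phi>_def tu)
  qed auto
  have spS: "space S = UNIV" by (simp add: S_def space_PiM)
  have N: "sets N = sets S" "space N = UNIV" by (simp_all add: N_def spS)
  have NS: "(g \<in> N \<rightarrow>\<^sub>M L) = (g \<in> S \<rightarrow>\<^sub>M L)" for g and L :: "'c measure"
    by (rule arg_cong[where f="\<lambda>A. g \<in> A"]) (rule measurable_cong_sets[OF N(1) refl])
  have X'm[measurable]: "X' t \<in> S \<rightarrow>\<^sub>M count_space UNIV" for t
    unfolding X'_def S_def by measurable
  have Z'm[measurable]: "Z' k t \<in> S \<rightarrow>\<^sub>M count_space UNIV" for k t
    unfolding Z'_def X'_def S_def by (cases "t \<le> k") (simp_all, measurable)
  have X'\<Phi>: "X' t (\<Phi> \<omega>) = to_nat (X t \<omega>)" for t \<omega>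
    by (simp add: X'_def \<Phi>_def enc_def)
  have Z'\<Phi>: "Z' k t (\<Phi> \<omega>) = to_nat (Z k t \<omega>)" if "\<omega> \<in> space M" for k t \<omega>
    using that ZX by (simp add: Z'_def X'\<Phi>) (simp add: \<Phi>_def enc_def)
  have prob_N: "\<P>(w in N. P w) = \<P>(\<omega> in M. P (\<Phi> \<omega>))" if "Measurable.pred S P" for P
  proof -
    have "{w \<in> space N. P w} \<in> sets S"
      using that by (simp add: N spS[symmetric] pred_def)
    then show ?thesis
      unfolding N_def
      by (subst measure_distr) (auto simp: spS intro!: arg_cong[where f=prob])
  qed
  have int_N: "(\<integral>\<^sup>+w. h w \<partial>N) = (\<integral>\<^sup>+\<omega>. h (\<Phi> \<omega>) \<partial>M)" if "h \<in> borel_measurable S" for h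
    unfolding N_def using that by (simp add: nn_integral_distr)
  have pmf_out: "pmf (map_pmf to_nat q) y = 0" if "y \<notin> range (to_nat :: 'w \<Rightarrow> nat)" for q :: "'w pmf" and y
    using that by (auto simp: pmf_eq_0_set_pmf)
  have chain': "markov_chain N K' X'"
    unfolding markov_chain_def
  proof (intro conjI allI impI)
    show "prob_space N" unfolding N_def by (rule prob_space_distr) simp
    show "X' t \<in> N \<rightarrow>\<^sub>M count_space UNIV" for t by (simp add: NS)
    fix m n :: int and a :: "int \<Rightarrow> nat" and y :: nat
    assume mn: "m \<le> n" and pos: "0 < \<P>(w in N. \<forall>i\<in>{m..n}. X' i w = a i)"
    have eq1: "\<P>(w in N. \<forall>i\<in>{m..n}. X' i w = a i)
        = \<P>(\<omega> in M. \<forall>i\<in>{m..n}. to_nat (X i \<omega>) = a i)"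
      by (subst prob_N) (measurable, simp add: X'\<Phi>)
    have eq2: "\<P>(w in N. X' (n+1) w = y \<and> (\<forall>i\<in>{m..n}. X' i w = a i))
        = \<P>(\<omega> in M. to_nat (X (n+1) \<omega>) = y \<and> (\<forall>i\<in>{m..n}. to_nat (X i \<omega>) = a i))"
      by (subst prob_N) (measurable, simp add: X'\<Phi>)
    have "{\<omega>\<in>space M. \<forall>i\<in>{m..n}. to_nat (X i \<omega>) = a i} \<noteq> {}"
      using pos unfolding eq1 by (metis measure_empty less_irrefl)
    then obtain \<omega>0 where \<omega>0: "\<And>i. i \<in> {m..n} \<Longrightarrow> to_nat (X i \<omega>0) = a i" by blast
    define a' where "a' = (\<lambda>i. from_nat (a i) :: 'w)"
    have a': "to_nat (a' i) = a i" if "i \<in> {m..n}" for i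
      using \<omega>0[OF that] by (metis a'_def from_nat_to_nat)
    have ev: "(\<forall>i\<in>{m..n}. to_nat (X i \<omega>) = a i) = (\<forall>i\<in>{m..n}. X i \<omega> = a' i)" for \<omega>
      using a' by (metis to_nat_split)
    show "\<P>(w in N. X' (n + 1) w = y \<bar> \<forall>i\<in>{m..n}. X' i w = a i) = pmf (K' n (a n)) y"
    proof (cases "y \<in> range (to_nat :: 'w \<Rightarrow> nat)")
      case False
      then have "\<And>\<omega>. to_nat (X (n+1) \<omega>) \<noteq> y" by blast
      then show ?thesis using False by (simp add: cond_prob_def eq2 K'_def pmf_out)
    next
      case True
      then obtain y' :: 'w where y: "y = to_nat y'" by blast
      have "\<P>(\<omega> in M. X (n+1) \<omega> = y' \<bar> \<forall>i\<in>{m..n}. X i \<omega> = a' i) = pmf (K n (a' n)) y'"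
        using chain mn pos unfolding eq1 ev markov_chain_def by blast
      then show ?thesis
        unfolding cond_prob_def eq1 eq2 ev
        by (simp add: y K'_def pmf_map_inj' a'_def)
    qed
  qed
  have branched': "branched_copy N K' X' k (Z' k)" for k
    unfolding branched_copy_def
  proof (intro conjI allI impI ballI)
    show "Z' k t \<in> N \<rightarrow>\<^sub>M count_space UNIV" for t by (simp add: NS)
    show "Z' k t w = X' t w" if "t \<le> k" for t w using that by (simp add: Z'_def)
    fix m n :: int and a b :: "int \<Rightarrow> nat" and x y :: nat
    assume mn: "m \<le> n" and kn: "k \<le> n"
      and pos: "0 < \<P>(w in N. \<forall>i\<in>{m..n}. X' i w = a i \<and> Z' k i w = b i)"
    have eq1: "\<P>(w in N. \<forall>i\<in>{m..n}. X' i w = a i \<and> Z' k i w = b i)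
        = \<P>(\<omega> in M. \<forall>i\<in>{m..n}. to_nat (X i \<omega>) = a i \<and> to_nat (Z k i \<omega>) = b i)"
      by (subst prob_N) (measurable, simp add: X'\<Phi> Z'\<Phi> cong: conj_cong)
    have eq2: "\<P>(w in N. (X' (n+1) w = x \<and> Z' k (n+1) w = y) \<and>
          (\<forall>i\<in>{m..n}. X' i w = a i \<and> Z' k i w = b i))
        = \<P>(\<omega> in M. (to_nat (X (n+1) \<omega>) = x \<and> to_nat (Z k (n+1) \<omega>) = y) \<and>
          (\<forall>i\<in>{m..n}. to_nat (X i \<omega>) = a i \<and> to_nat (Z k i \<omega>) = b i))"
      by (subst prob_N) (measurable, simp add: X'\<Phi> Z'\<Phi> cong: conj_cong)
    have "{\<omega>\<in>space M. \<forall>i\<in>{m..n}. to_nat (X i \<omega>) = a i \<and> to_nat (Z k i \<omega>) = b i} \<noteq> {}"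
      using pos unfolding eq1 by (metis measure_empty less_irrefl)
    then obtain \<omega>0 where \<omega>0: "\<And>i. i \<in> {m..n} \<Longrightarrow>
        to_nat (X i \<omega>0) = a i \<and> to_nat (Z k i \<omega>0) = b i" by blast
    define a' where "a' = (\<lambda>i. from_nat (a i) :: 'w)"
    define b' where "b' = (\<lambda>i. from_nat (b i) :: 'w)"
    have a': "to_nat (a' i) = a i" and b': "to_nat (b' i) = b i" if "i \<in> {m..n}" for i
      using \<omega>0[OF that] by (metis a'_def from_nat_to_nat, metis b'_def from_nat_to_nat)
    have ev: "(\<forall>i\<in>{m..n}. to_nat (X i \<omega>) = a i \<and> to_nat (Z k i \<omega>) = b i)
        = (\<forall>i\<in>{m..n}. X i \<omega> = a' i \<and> Z k i \<omega> = b' i)" for \<omega>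
      using a' b' by (metis to_nat_split)
    show "\<P>(w in N. X' (n + 1) w = x \<and> Z' k (n + 1) w = y \<bar>
        \<forall>i\<in>{m..n}. X' i w = a i \<and> Z' k i w = b i) = pmf (K' n (a n)) x * pmf (K' n (b n)) y"
    proof (cases "x \<in> range (to_nat :: 'w \<Rightarrow> nat) \<and> y \<in> range (to_nat :: 'w \<Rightarrow> nat)")
      case False
      then have "\<And>\<omega>. \<not> (to_nat (X (n+1) \<omega>) = x \<and> to_nat (Z k (n+1) \<omega>) = y)" by blast
      then have "\<P>(\<omega> in M. (to_nat (X (n+1) \<omega>) = x \<and> to_nat (Z k (n+1) \<omega>) = y) \<and>
          (\<forall>i\<in>{m..n}. to_nat (X i \<omega>) = a i \<and> to_nat (Z k i \<omega>) = b i)) = 0"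
        by (simp only: simp_thms) simp
      then show ?thesis using False
        unfolding cond_prob_def eq2 by (auto simp: K'_def pmf_out)
    next
      case True
      then obtain x' y' :: 'w where xy: "x = to_nat x'" "y = to_nat y'" by blast
      have "\<P>(\<omega> in M. X (n+1) \<omega> = x' \<and> Z k (n+1) \<omega> = y' \<bar>
          \<forall>i\<in>{m..n}. X i \<omega> = a' i \<and> Z k i \<omega> = b' i) = pmf (K n (a' n)) x' * pmf (K n (b' n)) y'"
        using branched[of k] mn kn pos unfolding eq1 ev branched_copy_def by blast
      then show ?thesis
        unfolding cond_prob_def eq1 eq2 ev
        by (simp add: xy K'_def pmf_map_inj' a'_def b'_def)
    qed
  qed
  have "range f' \<subseteq> mspace m" using f by (auto simp: f'_def)
  then have ineq: "markov_convexity_inequality m p C N X' Z' f'"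
    using conv chain' branched' unfolding markov_convex_with_def by blast
  have [measurable]: "(\<lambda>w. mdist m (f' (U w)) (f' (V w))) \<in> borel_measurable S"
    if U: "U \<in> S \<rightarrow>\<^sub>M count_space UNIV" and V: "V \<in> S \<rightarrow>\<^sub>M count_space UNIV" for U V
    by (rule measurable_compose_countable[OF _ U]) (rule measurable_compose[OF V], simp)
  have i1: "(\<integral>\<^sup>+w. ennreal (mdist m (f' (X' t w)) (f' (Z' k t w)) powr p) \<partial>N)
      = (\<integral>\<^sup>+\<omega>. ennreal (mdist m (f (X t \<omega>)) (f (Z k t \<omega>)) powr p) \<partial>M)" for t k
    by (subst int_N) (measurable, auto intro!: nn_integral_cong simp: X'\<Phi> Z'\<Phi> f'_def)
  have i2: "(\<integral>\<^sup>+w. ennreal (mdist m (f' (X' t w)) (f' (X' s w)) powr p) \<partial>N)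
      = (\<integral>\<^sup>+\<omega>. ennreal (mdist m (f (X t \<omega>)) (f (X s \<omega>)) powr p) \<partial>M)" for t s
    by (subst int_N) (measurable, auto intro!: nn_integral_cong simp: X'\<Phi> f'_def)
  show ?thesis using ineq unfolding markov_convexity_inequality_def i1 i2 .
qed

section \<open>Lipschitz quotients\<close>

definition lipschitz_quotient_map :: "'x metric \<Rightarrow> 'y metric \<Rightarrow> ('x \<Rightarrow> 'y) \<Rightarrow> bool" where
  "lipschitz_quotient_map m1 m2 f \<longleftrightarrow>
     Lipschitz_continuous_map m1 m2 f \<and> f ` mspace m1 = mspace m2 \<and>
     (\<exists>c>0. \<forall>x\<in>mspace m1. \<forall>r>0. mball_of m2 (f x) (r / c) \<subseteq> f ` mball_of m1 x r)"

definition lipschitz_quotient_of :: "'y metric \<Rightarrow> 'x metric \<Rightarrow> bool" where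
  "lipschitz_quotient_of m2 m1 \<longleftrightarrow> (\<exists>f. lipschitz_quotient_map m1 m2 f)"

end

theory Submission
  imports Defs
begin

text \<open>
  Let \<open>q\<close> be a Lipschitz quotient from \<open>X\<close> onto \<open>Y\<close> and let \<open>f\<close> map the state space of a chain
  into \<open>Y\<close>.  Lifting \<open>f\<close> state by state to a map into \<open>X\<close> fails: nothing keeps the lifts of
  consecutive states close together.  But a single step can be lifted: if \<open>x\<close> lies over \<open>y\<close>, the
  ball condition gives a point over any \<open>y'\<close> at distance at most a constant times \<open>d y y'\<close> from \<open>x\<close>.
  So paths can be lifted, starting from an arbitrary point and lifting one step after the other
  (\<open>lipschitz_quotient_path_lift\<close>).

  The lift is therefore a function of the history of the chain.  The sequence of histories
  is again a Markov chain on a countable state space, provided that histories begin at some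
  finite time \<open>s\<close>; before \<open>s\<close> the history chain stands still (\<open>markov_chain_history\<close>).  If a copy of
  the chain is branched off at time \<open>k \<ge> s\<close>, its history chain is branched off the history chain at
  time \<open>k\<close>; for \<open>k < s\<close> the history chains cannot split before \<open>s\<close>, and a copy branched off
  at \<open>s\<close> serves (\<open>branched_copy_history\<close>).

  Now the convexity inequality of \<open>X\<close> is applied to the lift of the history chain.  Steps of the
  lift are at most a constant times the steps of \<open>f\<close> along the chain, and vanish up to time \<open>s\<close>; this
  bounds the right-hand side uniformly in \<open>s\<close>.  Since \<open>q\<close> is Lipschitz, every term on the left that
  branches at a time \<open>t - 2 ^ k \<ge> s\<close> dominates the corresponding term for \<open>f\<close> up to a constant.
  A finite partial sum of the left-hand side involves only finitely many branching times, so a suitable \<open>s\<close>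
  bounds it, and partial sums determine the sum in \<open>[0, \<infinity>]\<close>.
\<close>

section \<open>Histories of a process\<close>

text \<open>
  For times \<open>t < s\<close> the value is the one-element history \<open>[X s \<omega>]\<close>, which keeps the process defined
  on all integers and constant up to time \<open>s\<close>.
\<close>

definition history :: "int \<Rightarrow> (int \<Rightarrow> 's \<Rightarrow> 'w) \<Rightarrow> int \<Rightarrow> 's \<Rightarrow> 'w list" where
  "history s X t \<omega> = map (\<lambda>i. X i \<omega>) [s..max s t]"

definition history_kernel :: "int \<Rightarrow> (int \<Rightarrow> 'w \<Rightarrow> 'w pmf) \<Rightarrow> int \<Rightarrow> 'w list \<Rightarrow> 'w list pmf" where
  "history_kernel s K n h =
     (if n < s then return_pmf h else map_pmf (\<lambda>w. h @ [w]) (K n (last h)))"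

lemma history_Suc_before: "n < s \<Longrightarrow> history s X (n + 1) = history s X n"
  by (simp add: history_def fun_eq_iff)

lemma history_Suc: "s \<le> n \<Longrightarrow> history s X (n + 1) \<omega> = history s X n \<omega> @ [X (n + 1) \<omega>]"
  by (simp add: history_def upto_rec2)

lemma last_history: "last (history s X t \<omega>) = X (max s t) \<omega>"
  by (simp add: history_def upto_rec2[of s "max s t"])

lemma history_cong:
  "(\<And>i. s \<le> i \<Longrightarrow> i \<le> max s t \<Longrightarrow> X i \<omega> = Z i \<omega>') \<Longrightarrow> history s X t \<omega> = history s Z t \<omega>'"
  by (simp add: history_def)

lemma history_eqD:
  "history s X t \<omega> = history s X t \<omega>' \<Longrightarrow> s \<le> i \<Longrightarrow> i \<le> t \<Longrightarrow> X i \<omega> = X i \<omega>'"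
  by (auto simp: history_def)

text \<open>
  A realised window of histories that ends at a time \<open>n \<ge> s\<close> fixes exactly the states at the times
  \<open>s, \<dots>, n\<close>, wherever the window begins; this turns conditions on histories into the conditions
  on states that the Markov property speaks about.
\<close>

lemma history_window_iff:
  assumes "m \<le> n" "s \<le> n"
  shows "(\<forall>i\<in>{m..n}. history s X i \<omega> = history s X i \<omega>0) \<longleftrightarrow> (\<forall>i\<in>{s..n}. X i \<omega> = X i \<omega>0)"
proof
  assume "\<forall>i\<in>{m..n}. history s X i \<omega> = history s X i \<omega>0"
  then have "history s X n \<omega> = history s X n \<omega>0" using assms by auto
  then show "\<forall>i\<in>{s..n}. X i \<omega> = X i \<omega>0" by (auto dest: history_eqD)
next
  assume "\<forall>i\<in>{s..n}. X i \<omega> = X i \<omega>0"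
  then show "\<forall>i\<in>{m..n}. history s X i \<omega> = history s X i \<omega>0"
    using assms by (auto intro!: history_cong)
qed

lemma measurable_map_list_count_space:
  fixes X :: "'i \<Rightarrow> 's \<Rightarrow> 'w::countable"
  assumes [measurable]: "\<And>i. X i \<in> M \<rightarrow>\<^sub>M count_space UNIV"
  shows "(\<lambda>\<omega>. map (\<lambda>i. X i \<omega>) is) \<in> M \<rightarrow>\<^sub>M count_space UNIV"
proof (induction "is")
  case (Cons i js)
  note [measurable] = Cons.IH
  have "(\<lambda>\<omega>. X i \<omega> # map (\<lambda>i. X i \<omega>) js) \<in> M \<rightarrow>\<^sub>M count_space UNIV"
    by measurable
  then show ?case by simp
qed simp

lemma measurable_history:
  fixes X :: "int \<Rightarrow> 's \<Rightarrow> 'w::countable"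
  assumes "\<And>i. X i \<in> M \<rightarrow>\<^sub>M count_space UNIV"
  shows "history s X t \<in> M \<rightarrow>\<^sub>M count_space UNIV"
  unfolding history_def[abs_def] by (rule measurable_map_list_count_space) fact

lemma pmf_history_kernel_snoc:
  "s \<le> n \<Longrightarrow> pmf (history_kernel s K n h) (h @ [w]) = pmf (K n (last h)) w"
  using pmf_map_inj'[of "\<lambda>w. h @ [w]" "K n (last h)" w] by (simp add: history_kernel_def inj_def)

lemma pmf_history_kernel_not_snoc:
  "s \<le> n \<Longrightarrow> \<nexists>w. h' = h @ [w] \<Longrightarrow> pmf (history_kernel s K n h) h' = 0"
  by (auto simp: history_kernel_def pmf_eq_0_set_pmf)

lemma cond_prob_cong_event:
  assumes "\<And>\<omega>. \<omega> \<in> space M \<Longrightarrow> Q \<omega> \<longleftrightarrow> Q' \<omega>"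
    and "\<And>\<omega>. \<omega> \<in> space M \<Longrightarrow> Q \<omega> \<Longrightarrow> P \<omega> \<longleftrightarrow> P' \<omega>"
  shows "\<P>(\<omega> in M. P \<omega> \<bar> Q \<omega>) = \<P>(\<omega> in M. P' \<omega> \<bar> Q' \<omega>)"
proof -
  have "{\<omega> \<in> space M. P \<omega> \<and> Q \<omega>} = {\<omega> \<in> space M. P' \<omega> \<and> Q' \<omega>}"
    and "{\<omega> \<in> space M. Q \<omega>} = {\<omega> \<in> space M. Q' \<omega>}" using assms by auto
  then show ?thesis by (simp add: cond_prob_def)
qed

lemma cond_prob_const:
  assumes "\<P>(\<omega> in M. Q \<omega>) > 0"
  shows "\<P>(\<omega> in M. c \<bar> Q \<omega>) = of_bool c"
  using assms by (cases c) (simp_all add: cond_prob_def)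

lemma prob_pos_obtains:
  assumes "0 < \<P>(\<omega> in M. Q \<omega>)"
  obtains \<omega> where "\<omega> \<in> space M" "Q \<omega>"
  using assms by (metis (mono_tags, lifting) empty_Collect_eq less_irrefl measure_empty)

theorem markov_chain_history:
  fixes X :: "int \<Rightarrow> 's \<Rightarrow> 'w::countable"
  assumes "markov_chain M K X"
  shows "markov_chain M (history_kernel s K) (history s X)"
  unfolding markov_chain_def
proof (intro conjI allI impI)
  show "prob_space M" using assms by (simp add: markov_chain_def)
  show "history s X t \<in> M \<rightarrow>\<^sub>M count_space UNIV" for t
    using assms by (intro measurable_history) (simp add: markov_chain_def)
  fix m n :: int and a y
  assume mn: "m \<le> n" and pos: "0 < \<P>(\<omega> in M. \<forall>i\<in>{m..n}. history s X i \<omega> = a i)"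
  then obtain \<omega>0 where \<omega>0: "\<And>i. i \<in> {m..n} \<Longrightarrow> a i = history s X i \<omega>0"
    by (elim prob_pos_obtains) metis
  have an: "a n = history s X n \<omega>0" using \<omega>0 mn by simp
  let ?Q = "\<lambda>\<omega>. \<forall>i\<in>{m..n}. history s X i \<omega> = a i"
  show "\<P>(\<omega> in M. history s X (n + 1) \<omega> = y \<bar> ?Q \<omega>) = pmf (history_kernel s K n (a n)) y"
  proof (cases "n < s")
    case True
    have "\<P>(\<omega> in M. history s X (n + 1) \<omega> = y \<bar> ?Q \<omega>) = \<P>(\<omega> in M. a n = y \<bar> ?Q \<omega>)"
      using mn True by (intro cond_prob_cong_event) (auto simp: history_Suc_before)
    then show ?thesis
      using True cond_prob_const[OF pos] by (auto simp: history_kernel_def pmf_return)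
  next
    case False
    then have sn: "s \<le> n" by simp
    have Q: "?Q \<omega> \<longleftrightarrow> (\<forall>i\<in>{s..n}. X i \<omega> = X i \<omega>0)" for \<omega>
      using history_window_iff[OF mn sn] \<omega>0 by simp
    have step: "history s X (n + 1) \<omega> = a n @ [X (n + 1) \<omega>]" if "?Q \<omega>" for \<omega>
      using that mn sn by (simp add: history_Suc)
    show ?thesis
    proof (cases "\<exists>x. y = a n @ [x]")
      case True
      then obtain x where y: "y = a n @ [x]" by blast
      have "\<P>(\<omega> in M. history s X (n + 1) \<omega> = y \<bar> ?Q \<omega>)
          = \<P>(\<omega> in M. X (n + 1) \<omega> = x \<bar> \<forall>i\<in>{s..n}. X i \<omega> = X i \<omega>0)"
        using step by (intro cond_prob_cong_event Q) (simp add: y)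
      also have "\<dots> = pmf (K n (X n \<omega>0)) x"
      proof -
        have "0 < \<P>(\<omega> in M. \<forall>i\<in>{m..n}. X i \<omega> = a i) \<Longrightarrow> m \<le> n \<Longrightarrow>
            \<P>(\<omega> in M. X (n + 1) \<omega> = y \<bar> \<forall>i\<in>{m..n}. X i \<omega> = a i) = pmf (K n (a n)) y" for m n a y
          using assms by (simp add: markov_chain_def)
        from this[of s n "\<lambda>i. X i \<omega>0" x] show ?thesis using sn pos unfolding Q by simp
      qed
      finally show ?thesis
        using sn by (simp add: y pmf_history_kernel_snoc an last_history max_def)
    next
      case False
      have "\<P>(\<omega> in M. history s X (n + 1) \<omega> = y \<bar> ?Q \<omega>) = \<P>(\<omega> in M. False \<bar> ?Q \<omega>)"
        using step False by (intro cond_prob_cong_event refl) auto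
      then show ?thesis
        using False sn cond_prob_const[OF pos] by (simp add: pmf_history_kernel_not_snoc)
    qed
  qed
qed

text \<open>
  Up to time \<open>s\<close> the history chain does not move, so a copy of it that is released at a time \<open>k < s\<close>
  has no freedom until \<open>s\<close>: it is the history of a copy of the chain that is released at time \<open>s\<close>.
\<close>

theorem branched_copy_history:
  fixes X :: "int \<Rightarrow> 's \<Rightarrow> 'w::countable"
  assumes X: "\<And>t. X t \<in> M \<rightarrow>\<^sub>M count_space UNIV" and branched: "branched_copy M K X (max k s) Z"
  shows "branched_copy M (history_kernel s K) (history s X) k (history s Z)"
  unfolding branched_copy_def
proof (intro conjI allI impI ballI)
  show "history s Z t \<in> M \<rightarrow>\<^sub>M count_space UNIV" for t
    using branched by (intro measurable_history) (simp add: branched_copy_def)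
  show "history s Z t \<omega> = history s X t \<omega>" if "t \<le> k" "\<omega> \<in> space M" for t \<omega>
    using branched that by (intro history_cong) (simp add: branched_copy_def)
  fix m n :: int and a b x y
  let ?Q = "\<lambda>\<omega>. \<forall>i\<in>{m..n}. history s X i \<omega> = a i \<and> history s Z i \<omega> = b i"
  let ?P = "\<lambda>\<omega>. history s X (n + 1) \<omega> = x \<and> history s Z (n + 1) \<omega> = y"
  assume mn: "m \<le> n" and kn: "k \<le> n" and pos: "0 < \<P>(\<omega> in M. ?Q \<omega>)"
  then obtain \<omega>0 where \<omega>0: "\<And>i. i \<in> {m..n} \<Longrightarrow> a i = history s X i \<omega>0"
      "\<And>i. i \<in> {m..n} \<Longrightarrow> b i = history s Z i \<omega>0"
    by (elim prob_pos_obtains) metis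
  have abn: "a n = history s X n \<omega>0" "b n = history s Z n \<omega>0" using \<omega>0 mn by simp_all
  show "\<P>(\<omega> in M. ?P \<omega> \<bar> ?Q \<omega>)
      = pmf (history_kernel s K n (a n)) x * pmf (history_kernel s K n (b n)) y"
  proof (cases "n < s")
    case True
    have "\<P>(\<omega> in M. ?P \<omega> \<bar> ?Q \<omega>) = \<P>(\<omega> in M. a n = x \<and> b n = y \<bar> ?Q \<omega>)"
      using mn True by (intro cond_prob_cong_event) (auto simp: history_Suc_before)
    then show ?thesis
      using True cond_prob_const[OF pos] by (auto simp: history_kernel_def pmf_return)
  next
    case False
    then have sn: "s \<le> n" by simp
    have Q: "?Q \<omega> \<longleftrightarrow> (\<forall>i\<in>{s..n}. X i \<omega> = X i \<omega>0 \<and> Z i \<omega> = Z i \<omega>0)" for \<omega>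
      using history_window_iff[OF mn sn, of X \<omega> \<omega>0] history_window_iff[OF mn sn, of Z \<omega> \<omega>0] \<omega>0
      by (auto simp: ball_conj_distrib)
    have step: "history s X (n + 1) \<omega> = a n @ [X (n + 1) \<omega>]"
        "history s Z (n + 1) \<omega> = b n @ [Z (n + 1) \<omega>]" if "?Q \<omega>" for \<omega>
      using that mn sn by (simp_all add: history_Suc)
    show ?thesis
    proof (cases "(\<exists>v. x = a n @ [v]) \<and> (\<exists>w. y = b n @ [w])")
      case True
      then obtain v w where xy: "x = a n @ [v]" "y = b n @ [w]" by blast
      have "\<P>(\<omega> in M. ?P \<omega> \<bar> ?Q \<omega>)
          = \<P>(\<omega> in M. X (n + 1) \<omega> = v \<and> Z (n + 1) \<omega> = w \<bar>
              \<forall>i\<in>{s..n}. X i \<omega> = X i \<omega>0 \<and> Z i \<omega> = Z i \<omega>0)"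
        using step by (intro cond_prob_cong_event Q) (simp add: xy)
      also have "\<dots> = pmf (K n (X n \<omega>0)) v * pmf (K n (Z n \<omega>0)) w"
      proof -
        have "0 < \<P>(\<omega> in M. \<forall>i\<in>{m..n}. X i \<omega> = a i \<and> Z i \<omega> = b i) \<Longrightarrow> m \<le> n \<Longrightarrow>
            max k s \<le> n \<Longrightarrow>
            \<P>(\<omega> in M. X (n + 1) \<omega> = x \<and> Z (n + 1) \<omega> = y \<bar>
                \<forall>i\<in>{m..n}. X i \<omega> = a i \<and> Z i \<omega> = b i) = pmf (K n (a n)) x * pmf (K n (b n)) y"
          for m n a b x y
          using branched by (simp add: branched_copy_def)
        from this[of s n "\<lambda>i. X i \<omega>0" "\<lambda>i. Z i \<omega>0" v w] show ?thesis
          using kn sn pos unfolding Q by simp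
      qed
      finally show ?thesis
        using sn by (simp add: xy pmf_history_kernel_snoc abn last_history max_def)
    next
      case False
      have "\<P>(\<omega> in M. ?P \<omega> \<bar> ?Q \<omega>) = \<P>(\<omega> in M. False \<bar> ?Q \<omega>)"
        using step False by (intro cond_prob_cong_event refl) auto
      moreover have "pmf (history_kernel s K n (a n)) x * pmf (history_kernel s K n (b n)) y = 0"
        using False sn by (auto simp: pmf_history_kernel_not_snoc)
      ultimately show ?thesis
        using cond_prob_const[OF pos] by simp
    qed
  qed
qed

section \<open>Lifting paths along a Lipschitz quotient\<close>

lemma mdist_self: "x \<in> mspace m \<Longrightarrow> mdist m x x = 0"
  by (rule mdist_zero[THEN iffD2]) simp_all

lemma lipschitz_quotient_step_lift:
  assumes "lipschitz_quotient_map A B q"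
  obtains D where "0 < D"
    and "\<And>x y. x \<in> mspace A \<Longrightarrow> y \<in> mspace B \<Longrightarrow>
           \<exists>x'\<in>mspace A. q x' = y \<and> mdist A x x' \<le> D * mdist B (q x) y"
proof -
  obtain c where c: "0 < c"
    and ball: "\<And>x r. x \<in> mspace A \<Longrightarrow> 0 < r \<Longrightarrow> mball_of B (q x) (r / c) \<subseteq> q ` mball_of A x r"
    using assms unfolding lipschitz_quotient_map_def by blast
  have qA: "q ` mspace A = mspace B" using assms by (simp add: lipschitz_quotient_map_def)
  have "\<exists>x'\<in>mspace A. q x' = y \<and> mdist A x x' \<le> 2 * c * mdist B (q x) y"
    if x: "x \<in> mspace A" and y: "y \<in> mspace B" for x y
  proof (cases "q x = y")
    case True
    then show ?thesis using x y c by (intro bexI[of _ x]) (simp_all add: mdist_self)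
  next
    case False
    have qx: "q x \<in> mspace B" using qA x by blast
    with False y have d: "0 < mdist B (q x) y"
      by (metis mdist_nonneg mdist_zero order_less_le)
    \<comment> \<open>Balls are open, so the radius in \<open>B\<close> must exceed the distance to \<open>y\<close>; twice that will do.\<close>
    define r where "r = 2 * c * mdist B (q x) y"
    have "0 < r" and "r / c = 2 * mdist B (q x) y" using c d by (simp_all add: r_def)
    then have "y \<in> q ` mball_of A x r" using ball[OF x] d qx y by (force simp: subset_iff)
    then show ?thesis by (auto simp: r_def intro: less_imp_le)
  qed
  then show ?thesis using c that[of "2 * c"] by simp
qed

text \<open>
  The constant depends on the quotient map alone.  The empty path is sent to an arbitrary
  base point, over which nothing is prescribed; a history always has at least one entry, so the
  base point is never the value of the lift along the chain.
\<close>

lemma lipschitz_quotient_path_lift: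
  assumes "lipschitz_quotient_map A B q"
  obtains D where "0 < D"
    and "\<And>f :: 'w \<Rightarrow> 'y. range f \<subseteq> mspace B \<Longrightarrow>
      \<exists>F. range F \<subseteq> mspace A \<and> (\<forall>h w. q (F (h @ [w])) = f w) \<and>
          (\<forall>h w. mdist A (F h) (F (h @ [w])) \<le> D * mdist B (q (F h)) (f w))"
proof -
  from assms obtain D where D: "0 < D"
    and "\<And>x y. x \<in> mspace A \<Longrightarrow> y \<in> mspace B \<Longrightarrow>
           \<exists>x'\<in>mspace A. q x' = y \<and> mdist A x x' \<le> D * mdist B (q x) y"
    by (rule lipschitz_quotient_step_lift) blast
  then obtain step where step:
    "\<And>x y. x \<in> mspace A \<Longrightarrow> y \<in> mspace B \<Longrightarrow>
       step x y \<in> mspace A \<and> q (step x y) = y \<and> mdist A x (step x y) \<le> D * mdist B (q x) y"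
    by metis
  have "\<exists>F. range F \<subseteq> mspace A \<and> (\<forall>h w. q (F (h @ [w])) = f w) \<and>
          (\<forall>h w. mdist A (F h) (F (h @ [w])) \<le> D * mdist B (q (F h)) (f w))"
    if f: "range f \<subseteq> mspace B" for f :: "'w \<Rightarrow> 'y"
  proof -
    have "mspace A \<noteq> {}" using f assms by (auto simp: lipschitz_quotient_map_def)
    then obtain x0 where x0: "x0 \<in> mspace A" by blast
    define F where "F = foldl (\<lambda>x w. step x (f w)) x0"
    have fB: "f w \<in> mspace B" for w using f by auto
    have F: "F h \<in> mspace A" for h
      by (induction h rule: rev_induct) (simp_all add: F_def x0 step fB)
    show ?thesis
      using F step[OF F fB] by (intro exI[of _ F]) (auto simp: F_def)
  qed
  with D show ?thesis by (rule that)
qed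

section \<open>Sums and moments in the extended nonnegative reals\<close>

lemma suminf_infsum_ennreal_le:
  fixes g :: "nat \<Rightarrow> 'a \<Rightarrow> ennreal"
  assumes "\<And>N F. finite F \<Longrightarrow> (\<Sum>k<N. \<Sum>t\<in>F. g k t) \<le> B"
  shows "(\<Sum>k. \<Sum>\<^sub>\<infinity>t\<in>UNIV. g k t) \<le> B"
proof (rule suminf_le_const)
  fix N
  have sum_on: "h summable_on UNIV" for h :: "'a \<Rightarrow> ennreal"
    by (rule nonneg_summable_on_complete) simp
  have "(\<Sum>k<N. \<Sum>\<^sub>\<infinity>t\<in>UNIV. g k t) = (\<Sum>\<^sub>\<infinity>t\<in>UNIV. \<Sum>k<N. g k t)"
    by (induction N) (simp_all add: infsum_add[OF sum_on sum_on])
  also have "\<dots> \<le> B"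
  proof (rule infsum_le_finite_sums[OF sum_on])
    fix F :: "'a set" assume "finite F"
    then show "(\<Sum>t\<in>F. \<Sum>k<N. g k t) \<le> B" using assms[of F N] by (subst sum.swap)
  qed
  finally show "(\<Sum>k<N. \<Sum>\<^sub>\<infinity>t\<in>UNIV. g k t) \<le> B" .
qed simp

lemma finite_sum_le_infsum_ennreal:
  fixes g :: "'a \<Rightarrow> ennreal"
  assumes "finite F"
  shows "(\<Sum>t\<in>F. g t) \<le> (\<Sum>\<^sub>\<infinity>t\<in>UNIV. g t)"
proof -
  have "infsum g F \<le> infsum g UNIV"
    by (rule infsum_mono_neutral) (auto intro: nonneg_summable_on_complete)
  then show ?thesis using assms by simp
qed

lemma finite_sum_le_suminf_infsum_ennreal:
  fixes g :: "nat \<Rightarrow> 'a \<Rightarrow> ennreal"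
  assumes "finite F"
  shows "(\<Sum>k<N. \<Sum>t\<in>F. g k t) \<le> (\<Sum>k. \<Sum>\<^sub>\<infinity>t\<in>UNIV. g k t)"
proof -
  have "(\<Sum>k<N. \<Sum>t\<in>F. g k t) \<le> (\<Sum>k<N. \<Sum>\<^sub>\<infinity>t\<in>UNIV. g k t)"
    using assms by (intro sum_mono finite_sum_le_infsum_ennreal)
  also have "\<dots> \<le> (\<Sum>k. \<Sum>\<^sub>\<infinity>t\<in>UNIV. g k t)" by (rule sum_le_suminf) auto
  finally show ?thesis .
qed

lemma nn_integral_powr_le:
  assumes "0 \<le> p" "0 \<le> L" and d: "d \<in> borel_measurable M"
    and "\<And>\<omega>. \<omega> \<in> space M \<Longrightarrow> 0 \<le> e \<omega> \<and> 0 \<le> d \<omega> \<and> e \<omega> \<le> L * d \<omega>"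
  shows "(\<integral>\<^sup>+\<omega>. ennreal (e \<omega> powr p) \<partial>M) \<le> ennreal (L powr p) * (\<integral>\<^sup>+\<omega>. ennreal (d \<omega> powr p) \<partial>M)"
proof -
  have "(\<integral>\<^sup>+\<omega>. ennreal (e \<omega> powr p) \<partial>M) \<le> (\<integral>\<^sup>+\<omega>. ennreal (L powr p) * ennreal (d \<omega> powr p) \<partial>M)"
  proof (rule nn_integral_mono)
    fix \<omega> assume "\<omega> \<in> space M"
    then have "e \<omega> powr p \<le> (L * d \<omega>) powr p" using assms by (intro powr_mono2) auto
    also have "\<dots> = L powr p * d \<omega> powr p" by (rule powr_mult)
    finally show "ennreal (e \<omega> powr p) \<le> ennreal (L powr p) * ennreal (d \<omega> powr p)"
      by (metis ennreal_leI ennreal_mult' powr_ge_zero)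
  qed
  also have "\<dots> = ennreal (L powr p) * (\<integral>\<^sup>+\<omega>. ennreal (d \<omega> powr p) \<partial>M)"
    using d by (intro nn_integral_cmult) measurable
  finally show ?thesis .
qed

lemma borel_measurable_countable_pair:
  fixes U :: "'s \<Rightarrow> 'w::countable" and g :: "'w \<Rightarrow> 'w \<Rightarrow> real"
  assumes "U \<in> M \<rightarrow>\<^sub>M count_space UNIV" "V \<in> M \<rightarrow>\<^sub>M count_space UNIV"
  shows "(\<lambda>\<omega>. g (U \<omega>) (V \<omega>)) \<in> borel_measurable M"
  by (rule measurable_compose_countable[OF _ assms(1)]) (rule measurable_compose[OF assms(2)], simp)

section \<open>Markov convexity of a Lipschitz quotient\<close>

lemma lipschitz_quotient_markov_convex_with:
  fixes A :: "'x metric" and B :: "'y metric"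
  assumes p: "0 < p" and C: "0 \<le> C" and conv: "markov_convex_with A p C"
    and quot: "lipschitz_quotient_map A B q"
  shows "\<exists>C'\<ge>0. markov_convex_with B p C'"
proof -
  obtain L where L: "0 < L"
    and lip: "\<And>x y. x \<in> mspace A \<Longrightarrow> y \<in> mspace A \<Longrightarrow> mdist B (q x) (q y) \<le> L * mdist A x y"
    using quot by (auto simp: lipschitz_quotient_map_def Lipschitz_continuous_map_pos)
  from quot obtain D where D: "0 < D"
    and lift: "\<And>f :: nat \<Rightarrow> 'y. range f \<subseteq> mspace B \<Longrightarrow>
      \<exists>F. range F \<subseteq> mspace A \<and> (\<forall>h w. q (F (h @ [w])) = f w) \<and>
          (\<forall>h w. mdist A (F h) (F (h @ [w])) \<le> D * mdist B (q (F h)) (f w))"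
    by (rule lipschitz_quotient_path_lift) blast
  have "markov_convexity_inequality B p (L * C * D) M X Z f"
    if chain: "markov_chain M K X" and branched: "\<And>k. branched_copy M K X k (Z k)"
      and f: "range f \<subseteq> mspace B"
    for M :: "(nat \<Rightarrow> nat) measure" and K :: "int \<Rightarrow> nat \<Rightarrow> nat pmf" and X Z f
  proof -
    have X: "X t \<in> M \<rightarrow>\<^sub>M count_space UNIV" for t
      using chain by (simp add: markov_chain_def)
    have Z: "Z k t \<in> M \<rightarrow>\<^sub>M count_space UNIV" for k t
      using branched by (simp add: branched_copy_def)
    obtain F where "range F \<subseteq> mspace A" and qF: "\<And>h w. q (F (h @ [w])) = f w"
      and stepF: "\<And>h w. mdist A (F h) (F (h @ [w])) \<le> D * mdist B (q (F h)) (f w)"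
      using lift[OF f] by blast
    then have F: "F h \<in> mspace A" for h by auto
    have qF_history: "q (F (history s W t \<omega>)) = f (W (max s t) \<omega>)"
      for s t \<omega> and W :: "int \<Rightarrow> (nat \<Rightarrow> nat) \<Rightarrow> nat"
      using qF[of "map (\<lambda>i. W i \<omega>) [s..max s t - 1]" "W (max s t) \<omega>"]
      by (simp add: history_def upto_rec2[of s "max s t"])
    define HX where "HX = (\<lambda>s. history s X)"
    define HZ where "HZ = (\<lambda>s k. history s (Z (max k s)))"
    have HX: "HX s t \<in> M \<rightarrow>\<^sub>M count_space UNIV" for s t
      unfolding HX_def using X by (rule measurable_history)
    have HZ: "HZ s k t \<in> M \<rightarrow>\<^sub>M count_space UNIV" for s k t
      unfolding HZ_def using Z by (rule measurable_history)
    note meas = borel_measurable_countable_pair[where g="\<lambda>u v. mdist A (F u) (F v)"]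
      borel_measurable_countable_pair[where g="\<lambda>u v. mdist B (f u) (f v)"]
    define lhs where "lhs = (\<lambda>k::nat. \<lambda>t.
      (\<integral>\<^sup>+\<omega>. ennreal (mdist B (f (X t \<omega>)) (f (Z (t - 2 ^ k) t \<omega>)) powr p) \<partial>M)
        / ennreal (2 powr (real k * p)))"
    define lhsF where "lhsF = (\<lambda>s. \<lambda>k::nat. \<lambda>t.
      (\<integral>\<^sup>+\<omega>. ennreal (mdist A (F (HX s t \<omega>)) (F (HZ s (t - 2 ^ k) t \<omega>)) powr p) \<partial>M)
        / ennreal (2 powr (real k * p)))"
    define rhs where "rhs = (\<lambda>t.
      \<integral>\<^sup>+\<omega>. ennreal (mdist B (f (X t \<omega>)) (f (X (t - 1) \<omega>)) powr p) \<partial>M)"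
    define rhsF where "rhsF = (\<lambda>s t.
      \<integral>\<^sup>+\<omega>. ennreal (mdist A (F (HX s t \<omega>)) (F (HX s (t - 1) \<omega>)) powr p) \<partial>M)"

    have convF: "(\<Sum>k. \<Sum>\<^sub>\<infinity>t\<in>UNIV. lhsF s k t) \<le> ennreal (C powr p) * (\<Sum>\<^sub>\<infinity>t\<in>UNIV. rhsF s t)" for s
    proof -
      have "markov_convexity_inequality A p C M (HX s) (HZ s) F"
        unfolding HX_def HZ_def
        using chain branched X F
        by (intro markov_convex_with_general[OF conv markov_chain_history branched_copy_history])
           auto
      then show ?thesis
        by (simp add: markov_convexity_inequality_def lhsF_def rhsF_def)
    qed

    have rhsF_le: "rhsF s t \<le> ennreal (D powr p) * rhs t" for s t
      unfolding rhs_def rhsF_def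
    proof (rule nn_integral_powr_le)
      fix \<omega>
      have "mdist A (F (HX s t \<omega>)) (F (HX s (t - 1) \<omega>)) \<le> D * mdist B (f (X t \<omega>)) (f (X (t - 1) \<omega>))"
      proof (cases "t \<le> s")
        case True
        then have "HX s t \<omega> = HX s (t - 1) \<omega>"
          using history_Suc_before[of "t - 1" s X] by (simp add: HX_def)
        then show ?thesis using F D by (simp add: mdist_self)
      next
        case False
        then have "HX s t \<omega> = HX s (t - 1) \<omega> @ [X t \<omega>]"
          using history_Suc[of s "t - 1" X \<omega>] by (simp add: HX_def)
        then have "mdist A (F (HX s (t - 1) \<omega>)) (F (HX s t \<omega>))
            \<le> D * mdist B (q (F (HX s (t - 1) \<omega>))) (f (X t \<omega>))"
          using stepF by simp
        also have "q (F (HX s (t - 1) \<omega>)) = f (X (t - 1) \<omega>)"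
          using False by (simp add: HX_def qF_history max_def)
        finally show ?thesis by (simp add: mdist_commute)
      qed
      then show "0 \<le> mdist A (F (HX s t \<omega>)) (F (HX s (t - 1) \<omega>)) \<and>
          0 \<le> mdist B (f (X t \<omega>)) (f (X (t - 1) \<omega>)) \<and>
          mdist A (F (HX s t \<omega>)) (F (HX s (t - 1) \<omega>)) \<le> D * mdist B (f (X t \<omega>)) (f (X (t - 1) \<omega>))"
        by simp
    qed (use p D X in \<open>auto intro: meas\<close>)

    have lhs_le: "lhs k t \<le> ennreal (L powr p) * lhsF s k t" if s: "s \<le> t - 2 ^ k" for s k t
    proof -
      have ts: "max s t = t" using s by (smt (verit) zero_less_power)
      have "(\<integral>\<^sup>+\<omega>. ennreal (mdist B (f (X t \<omega>)) (f (Z (t - 2 ^ k) t \<omega>)) powr p) \<partial>M)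
        \<le> ennreal (L powr p) *
          (\<integral>\<^sup>+\<omega>. ennreal (mdist A (F (HX s t \<omega>)) (F (HZ s (t - 2 ^ k) t \<omega>)) powr p) \<partial>M)"
      proof (rule nn_integral_powr_le)
        fix \<omega>
        have "f (X t \<omega>) = q (F (HX s t \<omega>))" and "f (Z (t - 2 ^ k) t \<omega>) = q (F (HZ s (t - 2 ^ k) t \<omega>))"
          using s by (simp_all add: HX_def HZ_def qF_history ts max.absorb1)
        then show "0 \<le> mdist B (f (X t \<omega>)) (f (Z (t - 2 ^ k) t \<omega>)) \<and>
            0 \<le> mdist A (F (HX s t \<omega>)) (F (HZ s (t - 2 ^ k) t \<omega>)) \<and>
            mdist B (f (X t \<omega>)) (f (Z (t - 2 ^ k) t \<omega>))
              \<le> L * mdist A (F (HX s t \<omega>)) (F (HZ s (t - 2 ^ k) t \<omega>))"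
          using lip[OF F F] by simp
      qed (use p L HX HZ in \<open>auto intro: meas\<close>)
      then show ?thesis
        unfolding lhs_def lhsF_def by (simp add: divide_right_mono_ennreal ennreal_times_divide)
    qed

    have infsum_rhsF: "(\<Sum>\<^sub>\<infinity>t\<in>UNIV. rhsF s t) \<le> ennreal (D powr p) * (\<Sum>\<^sub>\<infinity>t\<in>UNIV. rhs t)" for s
    proof (rule infsum_le_finite_sums)
      fix T :: "int set" assume "finite T"
      then show "(\<Sum>t\<in>T. rhsF s t) \<le> ennreal (D powr p) * (\<Sum>\<^sub>\<infinity>t\<in>UNIV. rhs t)"
        by (intro order_trans[OF sum_mono[OF rhsF_le]])
           (simp add: sum_distrib_left[symmetric] mult_left_mono finite_sum_le_infsum_ennreal)
    qed (auto intro: nonneg_summable_on_complete)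

    have "(\<Sum>k. \<Sum>\<^sub>\<infinity>t\<in>UNIV. lhs k t) \<le> ennreal ((L * C * D) powr p) * (\<Sum>\<^sub>\<infinity>t\<in>UNIV. rhs t)"
    proof (rule suminf_infsum_ennreal_le)
      fix N and T :: "int set" assume T: "finite T"
      \<comment> \<open>Histories must begin no later than any branching time \<open>t - 2 ^ k\<close> in the partial sum;
        inserting \<open>0\<close> keeps the minimum meaningful when \<open>T\<close> is empty.\<close>
      define s where "s = Min (insert 0 T) - 2 ^ N"
      have s: "s \<le> t - 2 ^ k" if "k < N" "t \<in> T" for k t
      proof -
        have "(2::int) ^ k \<le> 2 ^ N" using that by (intro power_increasing) auto
        moreover have "Min (insert 0 T) \<le> t" using T that by (intro Min_le) auto
        ultimately show ?thesis unfolding s_def by linarith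
      qed
      have "(\<Sum>k<N. \<Sum>t\<in>T. lhs k t) \<le> (\<Sum>k<N. \<Sum>t\<in>T. ennreal (L powr p) * lhsF s k t)"
        using s by (intro sum_mono lhs_le) auto
      also have "\<dots> = ennreal (L powr p) * (\<Sum>k<N. \<Sum>t\<in>T. lhsF s k t)"
        by (simp add: sum_distrib_left)
      also have "\<dots> \<le> ennreal (L powr p) * (\<Sum>k. \<Sum>\<^sub>\<infinity>t\<in>UNIV. lhsF s k t)"
        using T by (intro mult_left_mono finite_sum_le_suminf_infsum_ennreal) auto
      also have "\<dots> \<le> ennreal (L powr p) * (ennreal (C powr p) * (\<Sum>\<^sub>\<infinity>t\<in>UNIV. rhsF s t))"
        by (intro mult_left_mono convF) auto
      also have "\<dots> \<le> ennreal (L powr p) *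
          (ennreal (C powr p) * (ennreal (D powr p) * (\<Sum>\<^sub>\<infinity>t\<in>UNIV. rhs t)))"
        by (intro mult_left_mono infsum_rhsF) auto
      also have "\<dots> = ennreal ((L * C * D) powr p) * (\<Sum>\<^sub>\<infinity>t\<in>UNIV. rhs t)"
        using L C D by (simp add: powr_mult ennreal_mult mult.assoc)
      finally show "(\<Sum>k<N. \<Sum>t\<in>T. lhs k t) \<le> ennreal ((L * C * D) powr p) * (\<Sum>\<^sub>\<infinity>t\<in>UNIV. rhs t)" .
    qed
    then show ?thesis
      by (simp add: markov_convexity_inequality_def lhs_def rhs_def)
  qed
  then have "markov_convex_with B p (L * C * D)"
    unfolding markov_convex_with_def by blast
  then show ?thesis using L C D by (intro exI[of _ "L * C * D"]) simp
qed

lemma markov_convex_iff_with: "markov_convex m p \<longleftrightarrow> (\<exists>C\<ge>0. markov_convex_with m p C)"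
  by (auto simp: markov_convex_def markov_convexity_constant_def INF_less_iff)

theorem theorem1p4:
  fixes p :: real and X :: "'x metric" and Y :: "'y metric"
  assumes "0 < p"
    and "markov_convex X p"
    and "lipschitz_quotient_of Y X"
  shows "markov_convex Y p"
  using assms lipschitz_quotient_markov_convex_with
  unfolding markov_convex_iff_with lipschitz_quotient_of_def by blast

end
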